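(* Let $r\in\mathbb{N}$, $\alpha\in\mathbb{R}$, $\mathbf{x}_0\in\mathbb{R}^n$, and let $L$ be slowly varying at the origin. Let $f,g\in\mathcal{K}'_{M,r}(\mathbb{R}^n)$ (resp. $f,g\in\mathcal{S}'_r(\mathbb{R}^n)$) satisfy $$\lim_{\varepsilon\to0^+}\frac{f(\mathbf{x}_0+\varepsilon\mathbf{x})}{\varepsilon^\alpha L(\varepsilon)}=g(\mathbf{x})\quad\text{strongly in }\mathcal{K}'_{M,r}(\mathbb{R}^n)\ (\text{resp. }\mathcal{S}'_r(\mathbb{R}^n)).$$ If $\{q_\lambda f\}_{\lambda\in\mathbb{R}}$ is the multiresolution expansion of $f$ in an $(M,r)$-regular (resp. $r$-regular) MRA, then $$(q_\lambda f)(\mathbf{x}_0)=L(2^{-\lambda})\,(q_\lambda g_{\mathbf{x}_0})(\mathbf{x}_0)+o\big(2^{-\alpha\lambda}L(2^{-\lambda})\big)\quad\text{as }\lambda\to\infty,$$ where $g_{\mathbf{x}_0}(\mathbf{y})=g(\mathbf{y}-\mathbf{x}_0)$.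
   Context: $\mathbb{N}=\{0,1,2,\dots\}$. $M:[0,\infty)\to[0,\infty)$ is a continuous increasing function with $M(t)+M(s)\le M(t+s)$ and $M(t+s)\le M(2t)+M(2s)$ for all $t,s\ge0$; write $M(\mathbf{x})=M(|\mathbf{x}|)$ for $\mathbf{x}\in\mathbb{R}^n$. $\mathcal{K}_{M,r}(\mathbb{R}^n)$ is the Fréchet space of all $\varphi\in C^r(\mathbb{R}^n)$ such that for every $l\in\mathbb{N}$ the norm $\nu_{r,l}(\varphi)=\sup_{|\beta|\le r,\,\mathbf{x}\in\mathbb{R}^n}e^{M(l\mathbf{x})}|\varphi^{(\beta)}(\mathbf{x})|$ is finite, topologized by these norms. $\mathcal{S}_r(\mathbb{R}^n)$ is the Fréchet space of all $\varphi\in C^r(\mathbb{R}^n)$ such that for every $l\in\mathbb{N}$ the norm $\rho_{r,l}(\varphi)=\sup_{|\beta|\le r,\,\mathbf{x}\in\mathbb{R}^n}(1+|\mathbf{x}|)^l|\varphi^{(\beta)}(\mathbf{x})|$ is finite, topologized by these norms. $\mathcal{K}'_{M,r}$ and $\mathcal{S}'_r$ are the duals (spaces of distributions); strong convergence means uniform convergence on bounded sets of test functions. $\langle f(\mathbf{x}_0+\varepsilon\mathbf{x}),\varphi(\mathbf{x})\rangle=\varepsilon^{-n}\langle f(\mathbf{y}),\varphi((\mathbf{y}-\mathbf{x}_0)/\varepsilon)\rangle$ for $\varepsilon>0$. $L$ slowly varying at the origin: $L$ is a measurable, real-valued, positive function on an interval $(0,A]$ with $\lim_{\varepsilon\to0^+}L(a\varepsilon)/L(\varepsilon)=1$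 for each $a>0$. MRA: an increasing sequence $\{V_j\}_{j\in\mathbb{Z}}$ of closed linear subspaces of $L^2(\mathbb{R}^n)$ such that (i) $f\in V_j\Leftrightarrow f(2\,\cdot)\in V_{j+1}$; (ii) $f\in V_0\Leftrightarrow f(\cdot-\mathbf{m})\in V_0$ for $\mathbf{m}\in\mathbb{Z}^n$; (iii) $\bigcap_jV_j=\{0\}$ and $\overline{\bigcup_jV_j}=L^2(\mathbb{R}^n)$; (iv) there is a scaling function $\phi\in L^2(\mathbb{R}^n)$ such that $\{\phi(\cdot-\mathbf{m})\}_{\mathbf{m}\in\mathbb{Z}^n}$ is an orthonormal basis of $V_0$. The MRA is $(M,r)$-regular (resp. $r$-regular) if the scaling function can be chosen in $\mathcal{K}_{M,r}(\mathbb{R}^n)$ (resp. $\mathcal{S}_r(\mathbb{R}^n)$); such a $\phi$ is then fixed. Put $q_0(\mathbf{x},\mathbf{y})=\sum_{\mathbf{m}\in\mathbb{Z}^n}\phi(\mathbf{x}-\mathbf{m})\overline{\phi(\mathbf{y}-\mathbf{m})}$ and, for $\lambda\in\mathbb{R}$, $q_\lambda(\mathbf{x},\mathbf{y})=2^{n\lambda}q_0(2^\lambda\mathbf{x},2^\lambda\mathbf{y})$ and $(q_\lambda f)(\mathbf{x})=\langle f(\mathbf{y}),q_\lambda(\mathbf{x},\mathbf{y})\rangle_{\mathbf{y}}$ (bilinear pairing). *)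

theory Defs
  imports "HOL-Analysis.Analysis" "HOL-Library.Landau_Symbols"
begin

section \<open>Test functions\<close>

text \<open>
  Iterated partial derivatives are indexed by words in the coordinate directions. On \<open>C\<^sup>r\<close>
  functions the order of differentiation is immaterial, so the words of length at most \<open>r\<close>
  give exactly the derivatives \<open>\<phi>\<^sup>(\<^sup>\<beta>\<^sup>)\<close> with \<open>|\<beta>| \<le> r\<close>.
\<close>

primrec pderivs :: "'n list \<Rightarrow> (real^'n \<Rightarrow> complex) \<Rightarrow> real^'n \<Rightarrow> complex" where
  "pderivs [] \<phi> = \<phi>"
| "pderivs (i # is) \<phi> =
     (\<lambda>x. vector_derivative (\<lambda>t. pderivs is \<phi> (x + t *\<^sub>R axis i 1)) (at 0))"

definition C_r :: "nat \<Rightarrow> (real^'n \<Rightarrow> complex) set" where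
  "C_r r = {\<phi>.
     (\<forall>is. length is < r \<longrightarrow>
        (\<forall>i x. (\<lambda>t::real. pderivs is \<phi> (x + t *\<^sub>R axis i 1)) differentiable (at 0))) \<and>
     (\<forall>is. length is \<le> r \<longrightarrow> continuous_on UNIV (pderivs is \<phi>))}"

text \<open>
  A family of weights \<open>w l\<close>, \<open>l \<in> \<nat>\<close>, determines the norms
  \<open>sup {w l x * |\<phi>\<^sup>(\<^sup>\<beta>\<^sup>)(x)|. |\<beta>| \<le> r, x \<in> \<real>\<^sup>n}\<close> and the space of those \<open>\<phi> \<in> C\<^sup>r\<close> for
  which all of them are finite: \<open>K\<^sub>M\<^sub>,\<^sub>r\<close> for \<open>K_weight M\<close> and \<open>S\<^sub>r\<close> for \<open>S_weight\<close>.
\<close>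

type_synonym 'n weights = "nat \<Rightarrow> real^'n \<Rightarrow> real"

definition K_weight :: "(real \<Rightarrow> real) \<Rightarrow> 'n::finite weights" where
  "K_weight M l x = exp (M (norm (real l *\<^sub>R x)))"

definition S_weight :: "'n::finite weights" where
  "S_weight l x = (1 + norm x) ^ l"

text \<open>
  Monotonicity of \<open>M\<close> is not required to be strict; of the functions thus admitted only the
  degenerate \<open>M = 0\<close>, for which \<open>K\<^sub>M\<^sub>,\<^sub>r\<close> would impose no decay at all, is excluded.
  Every strictly increasing \<open>M\<close> with the remaining properties is covered.
\<close>

definition admissible :: "(real \<Rightarrow> real) \<Rightarrow> bool" where
  "admissible M \<longleftrightarrow>
     continuous_on {0..} M \<and> mono_on {0..} M \<and> (\<forall>t\<ge>0. M t \<ge> 0) \<and> (\<exists>t\<ge>0. M t \<noteq> 0) \<and>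
     (\<forall>t\<ge>0. \<forall>s\<ge>0. M t + M s \<le> M (t + s)) \<and>
     (\<forall>t\<ge>0. \<forall>s\<ge>0. M (t + s) \<le> M (2 * t) + M (2 * s))"

definition test_values ::
    "'n::finite weights \<Rightarrow> nat \<Rightarrow> nat \<Rightarrow> (real^'n \<Rightarrow> complex) \<Rightarrow> real set" where
  "test_values w r l \<phi> = {w l x * norm (pderivs is \<phi> x) | is x. length is \<le> r}"

definition test_space :: "'n::finite weights \<Rightarrow> nat \<Rightarrow> (real^'n \<Rightarrow> complex) set" where
  "test_space w r = {\<phi> \<in> C_r r. \<forall>l. bdd_above (test_values w r l \<phi>)}"

definition test_norm :: "'n::finite weights \<Rightarrow> nat \<Rightarrow> nat \<Rightarrow> (real^'n \<Rightarrow> complex) \<Rightarrow> real" where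
  "test_norm w r l \<phi> = Sup (test_values w r l \<phi>)"

definition test_topology :: "'n::finite weights \<Rightarrow> nat \<Rightarrow> (real^'n \<Rightarrow> complex) topology" where
  "test_topology w r = topology_generated_by
     {{\<psi> \<in> test_space w r. test_norm w r l (\<lambda>x. \<psi> x - \<phi> x) < e} | \<phi> l e.
        \<phi> \<in> test_space w r \<and> e > 0}"

definition test_bounded :: "'n::finite weights \<Rightarrow> nat \<Rightarrow> (real^'n \<Rightarrow> complex) set \<Rightarrow> bool" where
  "test_bounded w r B \<longleftrightarrow>
     B \<subseteq> test_space w r \<and> (\<forall>l. \<exists>C. \<forall>\<phi>\<in>B. test_norm w r l \<phi> \<le> C)"


section \<open>Distributions\<close>

type_synonym 'n functional = "(real^'n \<Rightarrow> complex) \<Rightarrow> complex"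

definition dual_space :: "'n::finite weights \<Rightarrow> nat \<Rightarrow> 'n functional set" where
  "dual_space w r = {f.
     (\<forall>\<phi>\<in>test_space w r. \<forall>\<psi>\<in>test_space w r. \<forall>a b.
        f (\<lambda>x. a * \<phi> x + b * \<psi> x) = a * f \<phi> + b * f \<psi>) \<and>
     continuous_map (test_topology w r) euclidean f}"

text \<open>The distribution \<open>f(a + \<epsilon>x)\<close>, for \<open>\<epsilon> > 0\<close>.\<close>

definition affine_dist :: "'n::finite functional \<Rightarrow> real^'n \<Rightarrow> real \<Rightarrow> 'n functional" where
  "affine_dist f a \<epsilon> \<phi> =
     complex_of_real (1 / \<epsilon> ^ CARD('n)) * f (\<lambda>y. \<phi> ((1 / \<epsilon>) *\<^sub>R (y - a)))"

definition translate_dist :: "'n::finite functional \<Rightarrow> real^'n \<Rightarrow> 'n functional" where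
  "translate_dist g a = affine_dist g (- a) 1"

definition strong_limit ::
    "'n::finite weights \<Rightarrow> nat \<Rightarrow> (real \<Rightarrow> 'n functional) \<Rightarrow> 'n functional \<Rightarrow> real filter \<Rightarrow> bool" where
  "strong_limit w r h g F \<longleftrightarrow> (\<forall>B. test_bounded w r B \<longrightarrow> uniform_limit B h g F)"

definition slowly_varying :: "(real \<Rightarrow> real) \<Rightarrow> bool" where
  "slowly_varying L \<longleftrightarrow>
     (\<exists>A>0. L \<in> borel_measurable (lebesgue_on {0<..A}) \<and> (\<forall>\<epsilon>\<in>{0<..A}. L \<epsilon> > 0)) \<and>
     (\<forall>a>0. ((\<lambda>\<epsilon>. L (a * \<epsilon>) / L \<epsilon>) \<longlongrightarrow> 1) (at_right 0))"


section \<open>Multiresolution analyses\<close>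

text \<open>
  Elements of \<open>L\<^sup>2\<close> are represented by functions. Subspaces of \<open>L\<^sup>2\<close> are sets of functions;
  those that are closed in the sense below are invariant under changes on null sets.
\<close>

definition L2 :: "(real^'n \<Rightarrow> complex) set" where
  "L2 = {f \<in> borel_measurable lebesgue. integrable lebesgue (\<lambda>x. (norm (f x))\<^sup>2)}"

definition L2_norm :: "(real^'n \<Rightarrow> complex) \<Rightarrow> real" where
  "L2_norm f = sqrt (\<integral>x. (norm (f x))\<^sup>2 \<partial>lebesgue)"

definition L2_inner :: "(real^'n \<Rightarrow> complex) \<Rightarrow> (real^'n \<Rightarrow> complex) \<Rightarrow> complex" where
  "L2_inner f g = (\<integral>x. f x * cnj (g x) \<partial>lebesgue)"

definition L2_closure :: "(real^'n \<Rightarrow> complex) set \<Rightarrow> (real^'n \<Rightarrow> complex) set" where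
  "L2_closure U = {f \<in> L2. \<forall>e>0. \<exists>g\<in>U. L2_norm (\<lambda>x. f x - g x) < e}"

definition closed_subspace :: "(real^'n \<Rightarrow> complex) set \<Rightarrow> bool" where
  "closed_subspace U \<longleftrightarrow>
     U \<subseteq> L2 \<and> (\<lambda>x. 0) \<in> U \<and>
     (\<forall>f\<in>U. \<forall>g\<in>U. \<forall>a b. (\<lambda>x. a * f x + b * g x) \<in> U) \<and>
     L2_closure U = U"

definition lattice_Z :: "(real^'n) set" where
  "lattice_Z = {m. \<forall>i. m $ i \<in> \<int>}"

definition scaling_function ::
    "(int \<Rightarrow> (real^'n \<Rightarrow> complex) set) \<Rightarrow> (real^'n \<Rightarrow> complex) \<Rightarrow> bool" where
  "scaling_function V \<phi> \<longleftrightarrow>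
     \<phi> \<in> L2 \<and>
     (\<forall>m\<in>lattice_Z. \<forall>k\<in>lattice_Z.
        L2_inner (\<lambda>x. \<phi> (x - m)) (\<lambda>x. \<phi> (x - k)) = (if m = k then 1 else 0)) \<and>
     L2_closure {(\<lambda>x. \<Sum>m\<in>F. c m * \<phi> (x - m)) | F c. finite F \<and> F \<subseteq> lattice_Z} = V 0"

definition is_MRA :: "(int \<Rightarrow> (real^'n \<Rightarrow> complex) set) \<Rightarrow> bool" where
  "is_MRA V \<longleftrightarrow>
     (\<forall>j. closed_subspace (V j)) \<and>
     (\<forall>j. V j \<subseteq> V (j + 1)) \<and>
     (\<forall>j. \<forall>f\<in>L2. f \<in> V j \<longleftrightarrow> (\<lambda>x. f (2 *\<^sub>R x)) \<in> V (j + 1)) \<and>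
     (\<forall>f\<in>L2. \<forall>m\<in>lattice_Z. f \<in> V 0 \<longleftrightarrow> (\<lambda>x. f (x - m)) \<in> V 0) \<and>
     (\<Inter>j. V j) = {f \<in> L2. AE x in lebesgue. f x = 0} \<and>
     L2_closure (\<Union>j. V j) = L2 \<and>
     (\<exists>\<phi>. scaling_function V \<phi>)"

definition q_zero :: "(real^'n \<Rightarrow> complex) \<Rightarrow> real^'n \<Rightarrow> real^'n \<Rightarrow> complex" where
  "q_zero \<phi> x y = (\<Sum>\<^sub>\<infinity>m\<in>lattice_Z. \<phi> (x - m) * cnj (\<phi> (y - m)))"

definition q_kernel ::
    "(real^'n::finite \<Rightarrow> complex) \<Rightarrow> real \<Rightarrow> real^'n \<Rightarrow> real^'n \<Rightarrow> complex" where
  "q_kernel \<phi> \<mu> x y =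
     complex_of_real (2 powr (real CARD('n) * \<mu>)) *
     q_zero \<phi> ((2 powr \<mu>) *\<^sub>R x) ((2 powr \<mu>) *\<^sub>R y)"

definition q_expansion ::
    "(real^'n::finite \<Rightarrow> complex) \<Rightarrow> real \<Rightarrow> 'n functional \<Rightarrow> real^'n \<Rightarrow> complex" where
  "q_expansion \<phi> \<mu> f x = f (\<lambda>y. q_kernel \<phi> \<mu> x y)"

end

theory Submission
  imports Defs
begin

text \<open>
  Put \<open>\<epsilon> = 2\<^sup>-\<^sup>\<mu>\<close>, \<open>c = x\<^sub>0 / \<epsilon>\<close> and \<open>\<psi>\<^sub>c(x) = q\<^sub>0(c, c + x)\<close>. A change of variables shows that
  \<open>(q\<^sub>\<mu> f)(x\<^sub>0)\<close> is the distribution \<open>f(x\<^sub>0 + \<epsilon>x)\<close> evaluated at \<open>\<psi>\<^sub>c\<close>, and likewise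
  \<open>(q\<^sub>\<mu> g\<^sub>x\<^sub>0)(x\<^sub>0)\<close> is \<open>g(\<epsilon>x)\<close> evaluated at \<open>\<psi>\<^sub>c\<close>, which is \<open>\<epsilon>\<^sup>\<alpha> g(\<psi>\<^sub>c)\<close> since a quasiasymptotic
  limit is homogeneous of degree \<open>\<alpha>\<close>. The family of all \<open>\<psi>\<^sub>c\<close> is bounded in the test space,
  so the strong limit, being uniform on this family, gives the claim. Only decay and growth of the
  weights enter, which allows both kinds of test spaces to be treated at once.
\<close>

section \<open>Iterated partial derivatives\<close>

text \<open>\<open>C_r\<close> asks for differentiability at parameter 0 only, but for every base
  point. Moving the base point to \<open>x + t *\<^sub>R axis i 1\<close> gives the derivative at
  every \<open>t\<close> along the line.\<close>

lemma C_r_pderivs_has_derivative: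
  assumes "\<phi> \<in> C_r r" "length is < r"
  shows "((\<lambda>t. pderivs is \<phi> (x + t *\<^sub>R axis i 1)) has_vector_derivative
           pderivs (i # is) \<phi> (x + t *\<^sub>R axis i 1)) (at t)"
proof -
  let ?y = "x + t *\<^sub>R axis i 1"
  have "(\<lambda>s::real. pderivs is \<phi> (?y + s *\<^sub>R axis i 1)) differentiable (at 0)"
    using assms unfolding C_r_def by blast
  then have d: "((\<lambda>s. pderivs is \<phi> (?y + s *\<^sub>R axis i 1)) has_vector_derivative
      pderivs (i # is) \<phi> ?y) (at 0)"
    by (simp add: vector_derivative_works)
  have s: "((\<lambda>s. s - t) has_vector_derivative 1) (at t)"
    by (auto intro!: derivative_eq_intros)
  have "((\<lambda>s. pderivs is \<phi> (?y + s *\<^sub>R axis i 1)) \<circ> (\<lambda>s. s - t) has_vector_derivative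
      1 *\<^sub>R pderivs (i # is) \<phi> ?y) (at t)"
    by (rule vector_diff_chain_at[OF s]) (use d in simp)
  then show ?thesis
    by (simp add: o_def algebra_simps)
qed

lemma C_r_continuous:
  "\<phi> \<in> C_r r \<Longrightarrow> length is \<le> r \<Longrightarrow> continuous_on UNIV (pderivs is \<phi>)"
  unfolding C_r_def by blast

lemma C_rI:
  assumes "\<And>is i x. length is < r \<Longrightarrow>
      (\<lambda>t::real. pderivs is \<phi> (x + t *\<^sub>R axis i 1)) differentiable (at 0)"
    and "\<And>is. length is \<le> r \<Longrightarrow> continuous_on UNIV (pderivs is \<phi>)"
  shows "\<phi> \<in> C_r r"
  using assms unfolding C_r_def by blast

section \<open>Affine substitution in \<open>C_r\<close> functions\<close>

context
  fixes T :: "complex \<Rightarrow> complex" and \<phi> :: "real^'n \<Rightarrow> complex" and r :: nat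
    and a :: real and b :: "real^'n"
  assumes T: "bounded_linear T" and \<phi>: "\<phi> \<in> C_r r"
begin

text \<open>The chain rule along a coordinate line contributes one factor \<open>a\<close>. The
  power \<open>a ^ k\<close> is carried along so that \<open>k = length is\<close> is the induction
  step for \<open>pderivs\<close>. \<open>T\<close> is merely real-linear, which admits complex
  conjugation besides the identity and multiplication by a constant.\<close>

lemma has_derivative_affine:
  assumes "length is < r"
  shows "((\<lambda>t. a ^ k *\<^sub>R T (pderivs is \<phi> (a *\<^sub>R (x + t *\<^sub>R axis i 1) + b))) has_vector_derivative
           a ^ Suc k *\<^sub>R T (pderivs (i # is) \<phi> (a *\<^sub>R x + b))) (at 0)"
proof -
  let ?g = "\<lambda>t. pderivs is \<phi> (a *\<^sub>R x + b + t *\<^sub>R axis i 1)"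
  have "(?g has_vector_derivative pderivs (i # is) \<phi> (a *\<^sub>R x + b + 0 *\<^sub>R axis i 1)) (at 0)"
    by (rule C_r_pderivs_has_derivative[OF \<phi> assms])
  then have g: "(?g has_vector_derivative pderivs (i # is) \<phi> (a *\<^sub>R x + b)) (at (a * 0))"
    by simp
  have s: "((\<lambda>t. a * t) has_vector_derivative a) (at 0)"
    by (auto intro!: derivative_eq_intros)
  have "(?g \<circ> (\<lambda>t. a * t) has_vector_derivative a *\<^sub>R pderivs (i # is) \<phi> (a *\<^sub>R x + b)) (at 0)"
    by (rule vector_diff_chain_at[OF s g])
  then have "((\<lambda>t. a ^ k *\<^sub>R T ((?g \<circ> (\<lambda>t. a * t)) t)) has_vector_derivative
      a ^ k *\<^sub>R T (a *\<^sub>R pderivs (i # is) \<phi> (a *\<^sub>R x + b))) (at 0)"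
    by (intro bounded_linear.has_vector_derivative[OF bounded_linear_scaleR_right]
        bounded_linear.has_vector_derivative[OF T])
  moreover have "a *\<^sub>R (x + t *\<^sub>R axis i 1) + b = a *\<^sub>R x + b + (a * t) *\<^sub>R axis i 1" for t
    by (simp add: algebra_simps)
  ultimately show ?thesis
    by (simp only: o_def linear_cmul[OF bounded_linear.linear[OF T]] scaleR_scaleR power_Suc2)
qed

lemma pderivs_affine:
  "length is \<le> r \<Longrightarrow>
     pderivs is (\<lambda>x. T (\<phi> (a *\<^sub>R x + b))) =
       (\<lambda>x. a ^ length is *\<^sub>R T (pderivs is \<phi> (a *\<^sub>R x + b)))"
proof (induction "is")
  case (Cons i "is")
  then show ?case
    using has_derivative_affine[of "is" "length is" _ i]
    by (auto simp: fun_eq_iff simp del: pderivs.simps(2)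
        simp add: pderivs.simps(2)[of i "is" "\<lambda>x. T (\<phi> (a *\<^sub>R x + b))"]
        intro!: vector_derivative_at)
qed simp

lemma C_r_affine: "(\<lambda>x. T (\<phi> (a *\<^sub>R x + b))) \<in> C_r r"
proof (rule C_rI)
  fix "is" :: "'n list" and i and x :: "real^'n"
  assume "length is < r"
  then show "(\<lambda>t. pderivs is (\<lambda>x. T (\<phi> (a *\<^sub>R x + b))) (x + t *\<^sub>R axis i 1)) differentiable (at 0)"
    using has_derivative_affine[of "is" "length is" x i]
    by (auto simp: pderivs_affine simp del: pderivs.simps(2) intro: differentiableI_vector)
next
  fix "is" :: "'n list"
  assume l: "length is \<le> r"
  have "continuous_on UNIV (\<lambda>x. pderivs is \<phi> (a *\<^sub>R x + b))"
    by (rule continuous_on_compose2[OF C_r_continuous[OF \<phi> l]]) (auto intro!: continuous_intros)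
  then show "continuous_on UNIV (pderivs is (\<lambda>x. T (\<phi> (a *\<^sub>R x + b))))"
    unfolding pderivs_affine[OF l]
    by (intro continuous_intros bounded_linear.continuous_on[OF T])
qed

end

text \<open>The majorant \<open>m\<close> makes the series of derivatives converge uniformly on the
  whole line, and pointwise convergence of the series itself then suffices for termwise
  differentiation.\<close>

lemma has_vector_derivative_suminf:
  fixes f :: "nat \<Rightarrow> real \<Rightarrow> 'b::banach"
  assumes der: "\<And>n t. (f n has_vector_derivative f' n t) (at t)"
    and bnd: "\<And>n t. norm (f' n t) \<le> m n" and m: "summable m"
    and sm: "\<And>t. summable (\<lambda>n. f n t)"
  shows "((\<lambda>t. \<Sum>n. f n t) has_vector_derivative (\<Sum>n. f' n t)) (at t)"
proof -
  let ?g' = "\<lambda>t. \<Sum>n. f' n t"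
  have ul: "uniform_limit UNIV (\<lambda>n t. \<Sum>i<n. f' i t) ?g' sequentially"
    by (rule Weierstrass_m_test[OF bnd m])
  have "\<exists>g. \<forall>t\<in>UNIV. (\<lambda>n. f n t) sums g t \<and> (g has_derivative (\<lambda>h. h *\<^sub>R ?g' t)) (at t within UNIV)"
  proof (rule has_derivative_series)
    show "(f n has_derivative (\<lambda>h. h *\<^sub>R f' n t)) (at t within UNIV)" for n t
      using der by (simp add: has_vector_derivative_def)
    show "(\<lambda>n. f n 0) sums (\<Sum>n. f n 0)"
      using sm by (rule summable_sums)
    fix e :: real
    assume "e > 0"
    then have "\<forall>\<^sub>F n in sequentially. \<forall>t\<in>UNIV. dist (\<Sum>i<n. f' i t) (?g' t) < e"
      using ul unfolding uniform_limit_iff by blast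
    \<comment> \<open>The error of the linear maps is measured relative to \<open>norm h\<close>; it
      is the uniform error of the derivative series times \<open>\<bar>h\<bar>\<close>.\<close>
    then show "\<forall>\<^sub>F n in sequentially. \<forall>t\<in>UNIV. \<forall>h.
        norm ((\<Sum>i<n. h *\<^sub>R f' i t) - h *\<^sub>R ?g' t) \<le> e * norm h"
    proof eventually_elim
      case (elim n)
      have "norm ((\<Sum>i<n. h *\<^sub>R f' i t) - h *\<^sub>R ?g' t) = \<bar>h\<bar> * dist (\<Sum>i<n. f' i t) (?g' t)" for h t
        by (simp add: dist_norm flip: scaleR_right_diff_distrib scaleR_sum_right)
      also have "\<bar>h\<bar> * dist (\<Sum>i<n. f' i t) (?g' t) \<le> \<bar>h\<bar> * e" for h t
        by (intro mult_left_mono) (use elim in \<open>auto simp: less_imp_le\<close>)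
      finally show ?case
        by (simp add: mult.commute)
    qed
  qed auto
  then obtain g where g: "\<And>t. (\<lambda>n. f n t) sums g t"
    and g': "\<And>t. (g has_derivative (\<lambda>h. h *\<^sub>R ?g' t)) (at t)"
    by auto
  have "(\<lambda>t. \<Sum>n. f n t) = g"
    using g by (auto simp: fun_eq_iff sums_iff)
  then show ?thesis
    using g' by (simp add: has_vector_derivative_def)
qed

section \<open>Series of translates of a \<open>C_r\<close> function\<close>

context
  fixes a :: "nat \<Rightarrow> complex" and p :: "nat \<Rightarrow> real^'n" and \<theta> :: "real^'n \<Rightarrow> complex"
    and r :: nat and B :: real
  assumes \<theta>: "\<theta> \<in> C_r r" and a: "summable (\<lambda>k. norm (a k))"
    and B: "\<And>is x. length is \<le> r \<Longrightarrow> norm (pderivs is \<theta> x) \<le> B"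
begin

text \<open>This majorant depends neither on \<open>x\<close> nor on the shifts \<open>p\<close>, so
  it serves every application of the Weierstrass test below.\<close>

lemma translates_bound:
  "length is \<le> r \<Longrightarrow> norm (a k * pderivs is \<theta> (x - p k)) \<le> norm (a k) * B"
  by (simp add: norm_mult mult_left_mono B)

lemma translates_norm_summable:
  assumes "length is \<le> r"
  shows "summable (\<lambda>k. norm (a k * pderivs is \<theta> (x - p k)))"
  by (rule summable_comparison_test'[OF summable_mult2[OF a]]) (use translates_bound assms in auto)

lemma has_derivative_translates:
  assumes "length is < r"
  shows "((\<lambda>t. \<Sum>k. a k * pderivs is \<theta> (x + t *\<^sub>R axis i 1 - p k)) has_vector_derivative
           (\<Sum>k. a k * pderivs (i # is) \<theta> (x - p k))) (at 0)"
proof -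
  have "((\<lambda>t. \<Sum>k. a k * pderivs is \<theta> (x + t *\<^sub>R axis i 1 - p k)) has_vector_derivative
           (\<Sum>k. a k * pderivs (i # is) \<theta> (x + 0 *\<^sub>R axis i 1 - p k))) (at 0)"
  proof (rule has_vector_derivative_suminf)
    fix k t
    have "((\<lambda>t. pderivs is \<theta> (x - p k + t *\<^sub>R axis i 1)) has_vector_derivative
            pderivs (i # is) \<theta> (x - p k + t *\<^sub>R axis i 1)) (at t)"
      by (rule C_r_pderivs_has_derivative[OF \<theta> assms])
    then show "((\<lambda>t. a k * pderivs is \<theta> (x + t *\<^sub>R axis i 1 - p k)) has_vector_derivative
            a k * pderivs (i # is) \<theta> (x + t *\<^sub>R axis i 1 - p k)) (at t)"
      by (intro has_vector_derivative_mult_right) (simp add: algebra_simps)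
    show "norm (a k * pderivs (i # is) \<theta> (x + t *\<^sub>R axis i 1 - p k)) \<le> norm (a k) * B"
      by (rule translates_bound) (use assms in simp)
  next
    show "summable (\<lambda>k. norm (a k) * B)"
      by (rule summable_mult2[OF a])
    show "summable (\<lambda>k. a k * pderivs is \<theta> (x + t *\<^sub>R axis i 1 - p k))" for t
      by (rule summable_norm_cancel[OF translates_norm_summable]) (use assms in simp)
  qed
  then show ?thesis
    by simp
qed

lemma pderivs_translates:
  "length is \<le> r \<Longrightarrow>
     pderivs is (\<lambda>x. \<Sum>k. a k * \<theta> (x - p k)) = (\<lambda>x. \<Sum>k. a k * pderivs is \<theta> (x - p k))"
proof (induction "is")
  case (Cons i "is")
  then show ?case
    using has_derivative_translates[of "is" _ i]
    by (auto simp: fun_eq_iff simp del: pderivs.simps(2)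
        simp add: pderivs.simps(2)[of i "is" "\<lambda>x. \<Sum>k. a k * \<theta> (x - p k)"]
        intro!: vector_derivative_at)
qed simp

text \<open>Derivatives pass through the sum up to order \<open>r\<close>; their continuity,
  including that of the top order, comes from uniform convergence of the differentiated
  series.\<close>

lemma C_r_translates: "(\<lambda>x. \<Sum>k. a k * \<theta> (x - p k)) \<in> C_r r"
proof (rule C_rI)
  fix "is" :: "'n list" and i and x :: "real^'n"
  assume "length is < r"
  then show "(\<lambda>t. pderivs is (\<lambda>x. \<Sum>k. a k * \<theta> (x - p k)) (x + t *\<^sub>R axis i 1)) differentiable (at 0)"
    using has_derivative_translates[of "is" x i]
    by (auto simp: pderivs_translates simp del: pderivs.simps(2) intro: differentiableI_vector)
next
  fix "is" :: "'n list"
  assume l: "length is \<le> r"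
  have c: "continuous_on UNIV (\<lambda>x. pderivs is \<theta> (x - p k))" for k
    by (rule continuous_on_compose2[OF C_r_continuous[OF \<theta> l]]) (auto intro!: continuous_intros)
  have "uniform_limit UNIV (\<lambda>n x. \<Sum>k<n. a k * pderivs is \<theta> (x - p k))
          (\<lambda>x. \<Sum>k. a k * pderivs is \<theta> (x - p k)) sequentially"
    by (rule Weierstrass_m_test[OF translates_bound[OF l] summable_mult2[OF a]])
  then show "continuous_on UNIV (pderivs is (\<lambda>x. \<Sum>k. a k * \<theta> (x - p k)))"
    unfolding pderivs_translates[OF l]
    by (rule uniform_limit_theorem[rotated])
       (auto intro!: always_eventually continuous_on_sum continuous_on_mult c)
qed

end

section \<open>Growing weights\<close>

text \<open>The index \<open>k\<close> and the constant \<open>C\<close> may depend on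
  \<open>l\<close>, \<open>a\<close> and \<open>N\<close>, never on the points.
  \<open>weight_diff\<close> distributes a weight over two factors, \<open>weight_mult\<close> sets
  some weight aside, and \<open>weight_growth\<close> converts that reserve into polynomial decay,
  hence into summability over the lattice.\<close>

locale growing_weight =
  fixes w :: "'n::finite weights"
  assumes weight_ge_1: "1 \<le> w l x"
    and weight_mult: "w l x * w k x \<le> w (l + k) x"
    and weight_diff: "\<exists>k C. \<forall>x y. w l (x - y) \<le> C * (w k x * w k y)"
    and weight_dilate: "\<exists>k C. \<forall>x. w l (a *\<^sub>R x) \<le> C * w k x"
    and weight_growth: "\<exists>k C. \<forall>x. (1 + norm x) ^ N \<le> C * w k x"

text \<open>Everything reduces to \<open>1 + norm (x - y) \<le> (1 + norm x) * (1 + norm y)\<close>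
  and its analogue for dilations, raised to the power \<open>l\<close>; the index never has to
  grow.\<close>

lemma growing_S_weight: "growing_weight (S_weight :: 'n::finite weights)"
proof
  fix l k N :: nat and a :: real and x :: "real^'n"
  show "1 \<le> S_weight l x"
    by (simp add: S_weight_def)
  show "S_weight l x * S_weight k x \<le> S_weight (l + k) x"
    by (simp add: S_weight_def power_add)
  have "S_weight l (x - y) \<le> 1 * (S_weight l x * S_weight l y)" for x y :: "real^'n"
  proof -
    have "1 + norm (x - y) \<le> 1 + norm x + norm y + norm x * norm y"
      using norm_triangle_ineq4[of x y] mult_nonneg_nonneg[OF norm_ge_zero norm_ge_zero, of x y]
      by linarith
    also have "\<dots> = (1 + norm x) * (1 + norm y)"
      by (simp add: algebra_simps)
    finally show ?thesis
      by (simp add: S_weight_def power_mono flip: power_mult_distrib)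
  qed
  then show "\<exists>k C. \<forall>x y :: real^'n. S_weight l (x - y) \<le> C * (S_weight k x * S_weight k y)"
    by blast
  have "S_weight l (a *\<^sub>R x) \<le> (1 + \<bar>a\<bar>) ^ l * S_weight l x" for x :: "real^'n"
  proof -
    have "1 + \<bar>a\<bar> * norm x \<le> (1 + \<bar>a\<bar>) * (1 + norm x)"
      by (simp add: algebra_simps)
    then show ?thesis
      by (simp add: S_weight_def power_mono flip: power_mult_distrib)
  qed
  then show "\<exists>k C. \<forall>x :: real^'n. S_weight l (a *\<^sub>R x) \<le> C * S_weight k x"
    by blast
  have "(1 + norm x) ^ N \<le> 1 * S_weight N x" for x :: "real^'n"
    by (simp add: S_weight_def)
  then show "\<exists>k C. \<forall>x :: real^'n. (1 + norm x) ^ N \<le> C * S_weight k x"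
    by blast
qed

text \<open>Superadditivity gives linear growth along the multiples of a point where
  \<open>M\<close> is positive, and monotonicity fills the gaps between them at the cost of a
  constant.\<close>

lemma admissible_linear_growth:
  assumes "admissible M"
  obtains b d where "b > 0" "\<And>t. t \<ge> 0 \<Longrightarrow> b * t - d \<le> M t"
proof -
  have mono: "\<And>s t. 0 \<le> s \<Longrightarrow> s \<le> t \<Longrightarrow> M s \<le> M t"
    and nn: "\<And>t. 0 \<le> t \<Longrightarrow> 0 \<le> M t"
    and super: "\<And>s t. 0 \<le> s \<Longrightarrow> 0 \<le> t \<Longrightarrow> M s + M t \<le> M (s + t)"
    using assms unfolding admissible_def mono_on_def by auto
  obtain t\<^sub>0 where t\<^sub>0: "t\<^sub>0 \<ge> 0" "M t\<^sub>0 \<noteq> 0"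
    using assms unfolding admissible_def by blast
  \<comment> \<open>Superadditivity at 0 reads \<open>2 * M 0 \<le> M 0\<close>.\<close>
  have "M 0 = 0"
    using super[of 0 0] nn[of 0] by simp
  then have "t\<^sub>0 > 0" "M t\<^sub>0 > 0"
    using t\<^sub>0 nn[of t\<^sub>0] by (auto simp: less_le)
  have mult: "real j * M t\<^sub>0 \<le> M (real j * t\<^sub>0)" for j
  proof (induction j)
    case (Suc j)
    then show ?case
      using super[of "real j * t\<^sub>0" t\<^sub>0] t\<^sub>0 by (simp add: algebra_simps)
  qed (simp add: \<open>M 0 = 0\<close>)
  have "M t\<^sub>0 / t\<^sub>0 * t - M t\<^sub>0 \<le> M t" if "t \<ge> 0" for t
  proof -
    \<comment> \<open>\<open>j\<close> counts the whole steps of length \<open>t\<^sub>0\<close>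
      that fit below \<open>t\<close>. Rounding loses less than one step, which accounts for the
      subtracted \<open>M t\<^sub>0\<close>.\<close>
    define j where "j = nat \<lfloor>t / t\<^sub>0\<rfloor>"
    have j: "real j \<le> t / t\<^sub>0" "t / t\<^sub>0 \<le> real j + 1"
      using that \<open>t\<^sub>0 > 0\<close> unfolding j_def by (auto simp: of_nat_nat)
    have "(t / t\<^sub>0) * M t\<^sub>0 \<le> (real j + 1) * M t\<^sub>0"
      using j \<open>M t\<^sub>0 > 0\<close> by (intro mult_right_mono) auto
    moreover have "M (real j * t\<^sub>0) \<le> M t"
      using j \<open>t\<^sub>0 > 0\<close> by (intro mono) (auto simp: field_simps)
    ultimately show ?thesis
      using mult[of j] by (simp add: algebra_simps)
  qed
  then show ?thesis
    using that[of "M t\<^sub>0 / t\<^sub>0" "M t\<^sub>0"] \<open>t\<^sub>0 > 0\<close> \<open>M t\<^sub>0 > 0\<close> by simp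
qed

text \<open>After taking logarithms, \<open>weight_mult\<close> is superadditivity and
  \<open>weight_diff\<close> is the inequality with doubled arguments, which is why the index
  doubles. Linear growth of \<open>M\<close> makes the weights dominate every power.\<close>

lemma growing_K_weight:
  assumes M: "admissible M"
  shows "growing_weight (K_weight M :: 'n::finite weights)"
proof
  have mono: "\<And>s t. 0 \<le> s \<Longrightarrow> s \<le> t \<Longrightarrow> M s \<le> M t"
    and nn: "\<And>t. 0 \<le> t \<Longrightarrow> 0 \<le> M t"
    and super: "\<And>s t. 0 \<le> s \<Longrightarrow> 0 \<le> t \<Longrightarrow> M s + M t \<le> M (s + t)"
    and sub: "\<And>s t. 0 \<le> s \<Longrightarrow> 0 \<le> t \<Longrightarrow> M (s + t) \<le> M (2 * s) + M (2 * t)"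
    using M unfolding admissible_def mono_on_def by auto
  fix l k N :: nat and a :: real and x :: "real^'n"
  show "1 \<le> K_weight M l x"
    by (simp add: K_weight_def nn)
  show "K_weight M l x * K_weight M k x \<le> K_weight M (l + k) x"
    using super[of "l * norm x" "k * norm x"]
    by (simp add: K_weight_def distrib_right flip: exp_add)
  have "K_weight M l (x - y) \<le> 1 * (K_weight M (2 * l) x * K_weight M (2 * l) y)"
    for x y :: "real^'n"
  proof -
    have "M (l * norm (x - y)) \<le> M (l * norm x + l * norm y)"
      using mult_left_mono[OF norm_triangle_ineq4[of x y], of l]
      by (intro mono) (auto simp: algebra_simps)
    also have "\<dots> \<le> M (2 * (l * norm x)) + M (2 * (l * norm y))"
      by (rule sub) auto
    finally show ?thesis
      by (simp add: K_weight_def mult.assoc flip: exp_add)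
  qed
  then show "\<exists>k C. \<forall>x y :: real^'n. K_weight M l (x - y) \<le> C * (K_weight M k x * K_weight M k y)"
    by blast
  \<comment> \<open>Indices are natural numbers, so the dilation factor is rounded up and absorbed
    by monotonicity.\<close>
  define k where "k = nat \<lceil>l * \<bar>a\<bar>\<rceil>"
  have k: "l * \<bar>a\<bar> \<le> real k"
    unfolding k_def by (rule real_nat_ceiling_ge)
  have "K_weight M l (a *\<^sub>R x) \<le> 1 * K_weight M k x" for x :: "real^'n"
    using mult_right_mono[OF k norm_ge_zero[of x]]
    by (auto simp: K_weight_def abs_mult mult.assoc intro!: mono)
  then show "\<exists>k C. \<forall>x :: real^'n. K_weight M l (a *\<^sub>R x) \<le> C * K_weight M k x"
    by blast
  obtain b d where "b > 0" and bd: "\<And>t. t \<ge> 0 \<Longrightarrow> b * t - d \<le> M t"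
    using admissible_linear_growth[OF M] by metis
  \<comment> \<open>The index is chosen with \<open>N \<le> b * j\<close>, so that
    \<open>M (j * norm x)\<close> is at least \<open>N * norm x - d\<close>.\<close>
  define j where "j = nat \<lceil>N / b\<rceil>"
  have "N / b \<le> j"
    unfolding j_def by (rule real_nat_ceiling_ge)
  then have j: "N \<le> b * j"
    using \<open>b > 0\<close> by (simp add: field_simps)
  have "(1 + norm x) ^ N \<le> exp d * K_weight M j x" for x :: "real^'n"
  proof -
    have "(1 + norm x) ^ N \<le> exp (norm x) ^ N"
      by (intro power_mono) auto
    also have "\<dots> = exp (N * norm x)"
      by (simp add: exp_of_nat_mult)
    also have "N * norm x \<le> b * (j * norm x)"
      using mult_right_mono[OF j norm_ge_zero[of x]] by (simp add: algebra_simps)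
    then have "exp (N * norm x) \<le> exp (d + M (j * norm x))"
      using bd[of "j * norm x"] by (simp add: algebra_simps)
    finally show ?thesis
      by (simp add: K_weight_def exp_add)
  qed
  then show "\<exists>k C. \<forall>x :: real^'n. (1 + norm x) ^ N \<le> C * K_weight M k x"
    by blast
qed

section \<open>Test functions under affine substitution\<close>

context growing_weight
begin

lemma weight_pos: "0 < w l x"
  using weight_ge_1[of l x] by linarith

lemma test_spaceI:
  assumes "\<phi> \<in> C_r r"
    and "\<And>l. \<exists>C. \<forall>is x. length is \<le> r \<longrightarrow> w l x * norm (pderivs is \<phi> x) \<le> C"
  shows "\<phi> \<in> test_space w r"
  using assms unfolding test_space_def test_values_def bdd_above_def by fast

lemma test_space_bound:
  assumes "\<phi> \<in> test_space w r"
  obtains C where "0 \<le> C"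
    "\<And>is x. length is \<le> r \<Longrightarrow> w l x * norm (pderivs is \<phi> x) \<le> C"
proof -
  obtain C where C: "\<And>v. v \<in> test_values w r l \<phi> \<Longrightarrow> v \<le> C"
    using assms unfolding test_space_def bdd_above_def by blast
  have *: "w l x * norm (pderivs is \<phi> x) \<le> C" if "length is \<le> r" for "is" x
    using that by (intro C) (auto simp: test_values_def)
  have "0 \<le> w l 0 * norm (pderivs [] \<phi> 0)"
    using weight_pos[of l 0] by simp
  also have "\<dots> \<le> C"
    using *[of "[]" 0] by simp
  finally show ?thesis
    using * that by blast
qed

text \<open>Since \<open>x\<close> is
  \<open>(1 / a) *\<^sub>R (a *\<^sub>R x + b) - (1 / a) *\<^sub>R b\<close>, splitting the
  difference and undoing the dilation bounds \<open>w l x\<close> by a multiple of a weight at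
  \<open>a *\<^sub>R x + b\<close>, where the decay of \<open>\<phi>\<close> applies.\<close>

lemma test_space_affine:
  assumes T: "bounded_linear T" and \<phi>: "\<phi> \<in> test_space w r" and "a \<noteq> 0"
  shows "(\<lambda>x. T (\<phi> (a *\<^sub>R x + b))) \<in> test_space w r"
proof (rule test_spaceI)
  have cr: "\<phi> \<in> C_r r"
    using \<phi> by (simp add: test_space_def)
  show "(\<lambda>x. T (\<phi> (a *\<^sub>R x + b))) \<in> C_r r"
    by (rule C_r_affine[OF T cr])
  fix l
  obtain K where K: "0 \<le> K" "\<And>z. norm (T z) \<le> K * norm z"
    using bounded_linear.nonneg_bounded[OF T] by (metis mult.commute)
  obtain k\<^sub>1 C\<^sub>1 where 1: "\<And>x y. w l (x - y) \<le> C\<^sub>1 * (w k\<^sub>1 x * w k\<^sub>1 y)"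
    using weight_diff by blast
  obtain k\<^sub>2 C\<^sub>2 where 2: "\<And>x. w k\<^sub>1 ((1 / a) *\<^sub>R x) \<le> C\<^sub>2 * w k\<^sub>2 x"
    using weight_dilate by blast
  obtain B where B: "0 \<le> B" "\<And>is x. length is \<le> r \<Longrightarrow> w k\<^sub>2 x * norm (pderivs is \<phi> x) \<le> B"
    using test_space_bound[OF \<phi>] by metis
  \<comment> \<open>The locale says nothing about the sign of its constants; positivity of the
    weights forces it.\<close>
  have "0 \<le> C\<^sub>1 * (w k\<^sub>1 0 * w k\<^sub>1 0)"
    using 1[of 0 0] weight_pos[of l 0] by simp
  then have C\<^sub>1: "0 \<le> C\<^sub>1"
    using weight_pos[of k\<^sub>1 0] by (auto simp: zero_le_mult_iff mult_le_0_iff)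
  define D where "D = C\<^sub>1 * C\<^sub>2 * w k\<^sub>1 ((1 / a) *\<^sub>R b)"
  have wD: "w l x \<le> D * w k\<^sub>2 (a *\<^sub>R x + b)" for x
  proof -
    have "w l x = w l ((1 / a) *\<^sub>R (a *\<^sub>R x + b) - (1 / a) *\<^sub>R b)"
      using \<open>a \<noteq> 0\<close> by (simp add: algebra_simps)
    also have "\<dots> \<le> C\<^sub>1 * (w k\<^sub>1 ((1 / a) *\<^sub>R (a *\<^sub>R x + b)) * w k\<^sub>1 ((1 / a) *\<^sub>R b))"
      by (rule 1)
    also have "\<dots> \<le> C\<^sub>1 * ((C\<^sub>2 * w k\<^sub>2 (a *\<^sub>R x + b)) * w k\<^sub>1 ((1 / a) *\<^sub>R b))"
      by (intro mult_left_mono mult_right_mono 2 C\<^sub>1 less_imp_le[OF weight_pos])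
    finally show ?thesis
      by (simp add: D_def mult_ac)
  qed
  have "0 \<le> D * w k\<^sub>2 (a *\<^sub>R 0 + b)"
    using wD[of 0] weight_pos[of l 0] by simp
  then have D: "0 \<le> D"
    using weight_pos[of k\<^sub>2 "a *\<^sub>R 0 + b"] by (simp add: zero_le_mult_iff)
  have "w l x * norm (pderivs is (\<lambda>x. T (\<phi> (a *\<^sub>R x + b))) x) \<le> D * (1 + \<bar>a\<bar>) ^ r * K * B"
    if "length is \<le> r" for "is" x
  proof -
    let ?z = "pderivs is \<phi> (a *\<^sub>R x + b)"
    \<comment> \<open>Passing to the base \<open>1 + \<bar>a\<bar>\<close>, which is at least 1,
      gives one bound for all word lengths up to \<open>r\<close>, also when
      \<open>\<bar>a\<bar> < 1\<close>.\<close>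
    have "\<bar>a\<bar> ^ length is \<le> (1 + \<bar>a\<bar>) ^ length is"
      by (intro power_mono) auto
    also have "\<dots> \<le> (1 + \<bar>a\<bar>) ^ r"
      by (intro power_increasing that) auto
    finally have pw: "\<bar>a\<bar> ^ length is \<le> (1 + \<bar>a\<bar>) ^ r" .
    have "w l x * norm (pderivs is (\<lambda>x. T (\<phi> (a *\<^sub>R x + b))) x)
        = w l x * (\<bar>a\<bar> ^ length is * norm (T ?z))"
      by (simp add: pderivs_affine[OF T cr that] power_abs)
    also have "\<dots> \<le> (D * w k\<^sub>2 (a *\<^sub>R x + b)) * ((1 + \<bar>a\<bar>) ^ r * (K * norm ?z))"
      using K D weight_pos less_imp_le[OF weight_pos]
      by (intro mult_mono wD pw) auto
    also have "\<dots> = D * (1 + \<bar>a\<bar>) ^ r * K * (w k\<^sub>2 (a *\<^sub>R x + b) * norm ?z)"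
      by (simp add: mult_ac)
    also have "\<dots> \<le> D * (1 + \<bar>a\<bar>) ^ r * K * B"
      using K D by (intro mult_left_mono B that mult_nonneg_nonneg) auto
    finally show ?thesis .
  qed
  then show "\<exists>C. \<forall>is x. length is \<le> r \<longrightarrow>
      w l x * norm (pderivs is (\<lambda>x. T (\<phi> (a *\<^sub>R x + b))) x) \<le> C"
    by blast
qed

end

section \<open>Sums over the integer lattice\<close>

text \<open>The bound must not depend on \<open>c\<close>. Replacing \<open>c\<close> by its floor
  costs a constant factor, and a shift of the summation index then removes it altogether.\<close>

lemma int_sum_bounded:
  obtains S where "\<And>(c::real) G. finite G \<Longrightarrow> (\<Sum>k\<in>G. 1 / (1 + \<bar>c - of_int k\<bar>)\<^sup>2) \<le> S"
proof -
  \<comment> \<open>This is the series of inverse squares shifted by one, so its term at 0 is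
    1.\<close>
  define h where "h = (\<lambda>j::nat. 1 / (1 + real j)\<^sup>2)"
  have "summable h"
    using summable_Suc_iff[THEN iffD2, OF inverse_power_summable[of 2, where 'a=real]]
    by (simp add: h_def inverse_eq_divide)
  have part: "(\<Sum>k\<in>G. h (nat \<bar>k\<bar>)) \<le> suminf h" if "finite G" "inj_on (\<lambda>k. nat \<bar>k\<bar>) G" for G :: "int set"
  proof -
    have "(\<Sum>k\<in>G. h (nat \<bar>k\<bar>)) = sum h ((\<lambda>k. nat \<bar>k\<bar>) ` G)"
      by (simp add: sum.reindex[OF that(2)])
    also have "\<dots> \<le> suminf h"
      by (rule sum_le_suminf[OF \<open>summable h\<close>]) (use that in \<open>auto simp: h_def\<close>)
    finally show ?thesis .
  qed
  have centred: "(\<Sum>k\<in>G. h (nat \<bar>k\<bar>)) \<le> 2 * suminf h" if "finite G" for G :: "int set"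
  proof -
    \<comment> \<open>The absolute value is injective on the non-negative and on the negative
      integers separately; each half contributes at most \<open>suminf h\<close>.\<close>
    have "(\<Sum>k\<in>G. h (nat \<bar>k\<bar>)) = (\<Sum>k\<in>G \<inter> {0..}. h (nat \<bar>k\<bar>)) + (\<Sum>k\<in>G - {0..}. h (nat \<bar>k\<bar>))"
      by (rule sum.Int_Diff[OF that])
    also have "\<dots> \<le> suminf h + suminf h"
      using that by (intro add_mono part) (auto simp: inj_on_def)
    finally show ?thesis
      by simp
  qed
  have "(\<Sum>k\<in>G. 1 / (1 + \<bar>c - of_int k\<bar>)\<^sup>2) \<le> 8 * suminf h" if "finite G" for c :: real and G
  proof -
    have "1 / (1 + \<bar>c - of_int k\<bar>)\<^sup>2 \<le> 4 * h (nat \<bar>k - \<lfloor>c\<rfloor>\<bar>)" for k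
    proof -
      \<comment> \<open>With \<open>y\<close> the floor of \<open>c\<close>, the distances of
        \<open>x\<close> to \<open>y\<close> and to \<open>c\<close> differ by at most 1. The factor
        2 becomes 4 after squaring.\<close>
      have "1 + \<bar>x - y\<bar> \<le> 2 * (1 + \<bar>c - x\<bar>)" if "y \<le> c" "c < y + 1" for x y
        using that by (auto simp: abs_if)
      from this[of "of_int \<lfloor>c\<rfloor>" "of_int k"] have "1 + \<bar>real_of_int (k - \<lfloor>c\<rfloor>)\<bar> \<le> 2 * (1 + \<bar>c - of_int k\<bar>)"
        by simp
      moreover have "1 / y\<^sup>2 \<le> 4 * (1 / x\<^sup>2)" if "x \<le> 2 * y" "0 < x" for x y :: real
        using that power_mono[of x "2 * y" 2] by (simp add: power_mult_distrib divide_simps)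
      ultimately show ?thesis
        by (simp add: h_def of_nat_nat add_pos_nonneg del: times_divide_eq_right)
    qed
    then have "(\<Sum>k\<in>G. 1 / (1 + \<bar>c - of_int k\<bar>)\<^sup>2) \<le> (\<Sum>k\<in>G. 4 * h (nat \<bar>k - \<lfloor>c\<rfloor>\<bar>))"
      by (intro sum_mono)
    also have "\<dots> = 4 * (\<Sum>k\<in>(\<lambda>k. k - \<lfloor>c\<rfloor>) ` G. h (nat \<bar>k\<bar>))"
      by (simp add: sum.reindex inj_on_def sum_distrib_left)
    also have "\<dots> \<le> 4 * (2 * suminf h)"
      using that by (intro mult_left_mono centred) auto
    finally show ?thesis
      by simp
  qed
  then show ?thesis
    using that by blast
qed

text \<open>The norm dominates each coordinate, so the exponent \<open>2 * CARD('n)\<close> leaves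
  an inverse square for every coordinate. Enlarging \<open>F\<close> to a box makes the sum a
  product of one-dimensional sums.\<close>

lemma lattice_sum_bounded:
  obtains S where "\<And>(c::real^'n) F. finite F \<Longrightarrow> F \<subseteq> lattice_Z \<Longrightarrow>
    (\<Sum>m\<in>F. 1 / (1 + norm (c - m)) ^ (2 * CARD('n))) \<le> S"
proof -
  obtain S where S: "\<And>(c::real) G. finite G \<Longrightarrow> (\<Sum>k\<in>G. 1 / (1 + \<bar>c - of_int k\<bar>)\<^sup>2) \<le> S"
    using int_sum_bounded by metis
  have "(\<Sum>m\<in>F. 1 / (1 + norm (c - m)) ^ (2 * CARD('n))) \<le> S ^ CARD('n)"
    if F: "finite F" "F \<subseteq> lattice_Z" for c :: "real^'n" and F
  proof -
    \<comment> \<open>The integer coordinates of a lattice point as a function of the index; the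
      floor is exact there.\<close>
    define fl where "fl = (\<lambda>(m::real^'n) i. \<lfloor>m $ i\<rfloor>)"
    define h where "h = (\<lambda>i k. 1 / (1 + \<bar>c $ i - of_int k\<bar>)\<^sup>2)"
    define G where "G = (\<lambda>i. (\<lambda>m. fl m i) ` F)"
    have fl: "of_int (fl m i) = m $ i" if "m \<in> F" for m i
    proof -
      have "m $ i \<in> \<int>"
        using that F by (auto simp: lattice_Z_def)
      then show ?thesis
        by (auto simp: fl_def elim: Ints_cases)
    qed
    have "inj_on fl F"
      using fl by (auto simp: inj_on_def vec_eq_iff) metis
    have h0: "0 \<le> h i k" for i k
      by (simp add: h_def)
    have "1 / (1 + norm (c - m)) ^ (2 * CARD('n)) \<le> (\<Prod>i\<in>UNIV. h i (fl m i))" if "m \<in> F" for m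
    proof -
      have "(\<Prod>i\<in>(UNIV::'n set). 1 / (1 + norm (c - m))\<^sup>2) \<le> (\<Prod>i\<in>UNIV. h i (fl m i))"
      proof (rule prod_mono)
        fix i
        have "\<bar>c $ i - m $ i\<bar> \<le> norm (c - m)"
          using component_le_norm_cart[of "c - m" i] by simp
        then show "0 \<le> 1 / (1 + norm (c - m))\<^sup>2 \<and> 1 / (1 + norm (c - m))\<^sup>2 \<le> h i (fl m i)"
          unfolding h_def fl[OF that]
          by (auto intro!: divide_left_mono power_mono mult_pos_pos zero_less_power
              simp: add_pos_nonneg)
      qed
      then show ?thesis
        by (simp add: power_divide power_mult)
    qed
    then have "(\<Sum>m\<in>F. 1 / (1 + norm (c - m)) ^ (2 * CARD('n)))
        \<le> (\<Sum>m\<in>F. \<Prod>i\<in>UNIV. h i (fl m i))"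
      by (intro sum_mono)
    also have "\<dots> = (\<Sum>u\<in>fl ` F. \<Prod>i\<in>UNIV. h i (u i))"
      by (simp add: sum.reindex[OF \<open>inj_on fl F\<close>])
    also have "\<dots> \<le> (\<Sum>u\<in>PiE UNIV G. \<Prod>i\<in>UNIV. h i (u i))"
      using F by (intro sum_mono2 finite_PiE prod_nonneg) (auto simp: G_def h0)
    also have "\<dots> = (\<Prod>i\<in>UNIV. \<Sum>k\<in>G i. h i k)"
      using F by (intro prod_sum_PiE[symmetric]) (auto simp: G_def)
    also have "\<dots> \<le> (\<Prod>i\<in>(UNIV::'n set). S)"
      using F S unfolding h_def by (intro prod_mono conjI sum_nonneg) (auto simp: G_def)
    finally show ?thesis
      by simp
  qed
  then show ?thesis
    using that by blast
qed

text \<open>An enumeration turns the unordered sum in \<open>q_zero\<close> into an ordinary series,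
  to which the termwise differentiation above applies.\<close>

lemma lattice_enumeration:
  obtains e :: "nat \<Rightarrow> real^'n" where "bij_betw e UNIV lattice_Z"
proof -
  have "countable (lattice_Z :: (real^'n) set)"
    unfolding lattice_Z_def by (rule countable_vector) (simp add: Ints_def)
  moreover have "infinite (lattice_Z :: (real^'n) set)"
  proof -
    have "range (\<lambda>k::nat. (\<chi> i. real k) :: real^'n) \<subseteq> lattice_Z"
      by (auto simp: lattice_Z_def)
    moreover have "inj (\<lambda>k::nat. (\<chi> i. real k) :: real^'n)"
      by (auto simp: inj_on_def vec_eq_iff)
    ultimately show ?thesis
      using infinite_super range_inj_infinite by blast
  qed
  ultimately show ?thesis
    using that bij_betw_from_nat_into by blast
qed

section \<open>The reproducing kernel\<close>

text \<open>The kernel is concentrated near the diagonal. Recentring its second variable at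
  \<open>c\<close> keeps the sections near the origin, which allows weighted bounds uniform in
  \<open>c\<close>.\<close>

definition kernel_section :: "(real^'n \<Rightarrow> complex) \<Rightarrow> real^'n \<Rightarrow> real^'n \<Rightarrow> complex" where
  "kernel_section \<phi> c x = q_zero \<phi> c (c + x)"

context growing_weight
begin

text \<open>A bound of \<open>\<phi>\<close> against the weight of index \<open>l + k\<close> leaves
  the weight of index \<open>k\<close> to spare. This reserve yields the decay that the lattice sum
  requires, uniformly in the centre and in the number of terms.\<close>

lemma weighted_lattice_sum_bounded:
  fixes e :: "nat \<Rightarrow> real^'n"
  assumes \<phi>: "\<phi> \<in> test_space w r" and e: "bij_betw e UNIV lattice_Z"
  obtains S where "\<And>c K. (\<Sum>j<K. w l (c - e j) * norm (\<phi> (c - e j))) \<le> S"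
proof -
  obtain k C where k: "\<And>x. (1 + norm x) ^ (2 * CARD('n)) \<le> C * w k x"
    using weight_growth by blast
  obtain B where B: "0 \<le> B" "\<And>is x. length is \<le> r \<Longrightarrow> w (l + k) x * norm (pderivs is \<phi> x) \<le> B"
    using test_space_bound[OF \<phi>] by metis
  obtain S where S: "\<And>(c::real^'n) F. finite F \<Longrightarrow> F \<subseteq> lattice_Z \<Longrightarrow>
      (\<Sum>m\<in>F. 1 / (1 + norm (c - m)) ^ (2 * CARD('n))) \<le> S"
    using lattice_sum_bounded by metis
  have "1 \<le> C * w k 0"
    using k[of 0] by simp
  then have C: "0 \<le> C"
    using weight_pos[of k 0] by (smt (verit) mult_nonpos_nonneg)
  have pt: "w l z * norm (\<phi> z) \<le> C * B * (1 / (1 + norm z) ^ (2 * CARD('n)))" for z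
  proof -
    have "w l z * norm (\<phi> z) * (1 + norm z) ^ (2 * CARD('n))
        \<le> w l z * norm (\<phi> z) * (C * w k z)"
      using weight_pos[of l z] by (intro mult_left_mono k) auto
    also have "\<dots> = C * (w l z * w k z * norm (\<phi> z))"
      by (simp add: mult_ac)
    also have "\<dots> \<le> C * (w (l + k) z * norm (\<phi> z))"
      by (intro mult_left_mono mult_right_mono weight_mult C norm_ge_zero)
    also have "\<dots> \<le> C * B"
      using B(2)[of "[]" z] C by (intro mult_left_mono) auto
    finally show ?thesis
      by (simp add: pos_le_divide_eq add_pos_nonneg)
  qed
  have "(\<Sum>j<K. w l (c - e j) * norm (\<phi> (c - e j))) \<le> C * B * S" for c K
  proof -
    have inj: "inj_on e {..<K}" and sub: "e ` {..<K} \<subseteq> lattice_Z"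
      using e by (auto simp: bij_betw_def intro: inj_on_subset)
    have "(\<Sum>j<K. w l (c - e j) * norm (\<phi> (c - e j)))
        \<le> (\<Sum>j<K. C * B * (1 / (1 + norm (c - e j)) ^ (2 * CARD('n))))"
      by (intro sum_mono pt)
    also have "\<dots> = C * B * (\<Sum>m\<in>e ` {..<K}. 1 / (1 + norm (c - m)) ^ (2 * CARD('n)))"
      by (simp add: sum.reindex[OF inj] sum_distrib_left)
    also have "\<dots> \<le> C * B * S"
      using C B by (intro mult_left_mono S sub) auto
    finally show ?thesis .
  qed
  then show ?thesis
    using that by blast
qed

text \<open>
  The weight of \<open>x = (c + x - m) - (c - m)\<close> splits between the two factors of
  \<open>\<phi> (c - m) * cnj (\<phi> (c + x - m))\<close>, which leaves a lattice sum bounded independently of \<open>c\<close>.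
\<close>

lemma kernel_sections_bounded:
  assumes \<phi>: "\<phi> \<in> test_space w r"
  shows "test_bounded w r (range (kernel_section \<phi>))"
proof -
  \<comment> \<open>Conjugation is real-linear, so \<open>\<theta>\<close> is again a test function;
    the kernel becomes a series of its translates with coefficients
    \<open>\<phi> (c - e j)\<close>.\<close>
  define \<theta> where "\<theta> = (\<lambda>x. cnj (\<phi> x))"
  have \<theta>: "\<theta> \<in> test_space w r"
    using test_space_affine[OF bounded_linear_cnj \<phi>, of 1 0] by (simp add: \<theta>_def)
  then have cr: "\<theta> \<in> C_r r"
    by (simp add: test_space_def)
  obtain e :: "nat \<Rightarrow> real^'n" where e: "bij_betw e UNIV lattice_Z"
    using lattice_enumeration by blast
  have summ: "summable (\<lambda>j. w l (c - e j) * norm (\<phi> (c - e j)))" for l c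
  proof -
    obtain S where "\<And>c K. (\<Sum>j<K. w l (c - e j) * norm (\<phi> (c - e j))) \<le> S"
      using weighted_lattice_sum_bounded[OF \<phi> e] by metis
    then show ?thesis
      using less_imp_le[OF weight_pos] by (intro summableI_nonneg_bounded) auto
  qed
  have a: "summable (\<lambda>j. norm (\<phi> (c - e j)))" for c
    by (rule summable_comparison_test'[OF summ[of 0 c]])
      (use mult_right_mono[OF weight_ge_1 norm_ge_zero] in auto)
  obtain B\<^sub>0 where B\<^sub>0: "\<And>is x. length is \<le> r \<Longrightarrow> w 0 x * norm (pderivs is \<theta> x) \<le> B\<^sub>0"
    using test_space_bound[OF \<theta>] by metis
  have \<theta>_bound: "norm (pderivs is \<theta> x) \<le> B\<^sub>0" if "length is \<le> r" for "is" x
  proof -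
    have "1 * norm (pderivs is \<theta> x) \<le> w 0 x * norm (pderivs is \<theta> x)"
      by (rule mult_right_mono[OF weight_ge_1 norm_ge_zero])
    then show ?thesis
      using B\<^sub>0[OF that, of x] by linarith
  qed
  note translates = cr a \<theta>_bound
  have series: "kernel_section \<phi> c = (\<lambda>x. \<Sum>j. \<phi> (c - e j) * \<theta> (x - (e j - c)))" for c
  proof
    fix x
    have sm: "summable (\<lambda>j. norm (\<phi> (c - e j) * \<theta> (x - (e j - c))))"
      using translates_norm_summable[OF translates, of "[]" c x "\<lambda>j. e j - c"] by simp
    \<comment> \<open>Absolute convergence identifies the unordered sum with the ordered
      series.\<close>
    have "(\<Sum>\<^sub>\<infinity>j. \<phi> (c - e j) * \<theta> (x - (e j - c))) = (\<Sum>j. \<phi> (c - e j) * \<theta> (x - (e j - c)))"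
      by (rule infsumI[OF norm_summable_imp_has_sum[OF sm summable_sums[OF summable_norm_cancel[OF sm]]]])
    moreover have "kernel_section \<phi> c x = (\<Sum>\<^sub>\<infinity>j. \<phi> (c - e j) * cnj (\<phi> (c + x - e j)))"
      unfolding kernel_section_def q_zero_def
      by (rule infsum_reindex_bij_betw[OF e, symmetric])
    ultimately show "kernel_section \<phi> c x = (\<Sum>j. \<phi> (c - e j) * \<theta> (x - (e j - c)))"
      by (simp add: \<theta>_def algebra_simps)
  qed
  \<comment> \<open>The constant is chosen before \<open>c\<close>; this uniformity is the
    boundedness of the family.\<close>
  have bound: "\<exists>C. \<forall>c is x. length is \<le> r \<longrightarrow> w l x * norm (pderivs is (kernel_section \<phi> c) x) \<le> C"
    for l
  proof -
    obtain k C where C: "\<And>x y. w l (x - y) \<le> C * (w k x * w k y)"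
      using weight_diff by blast
    have "0 \<le> C * (w k 0 * w k 0)"
      using C[of 0 0] weight_pos[of l 0] by simp
    then have C0: "0 \<le> C"
      using weight_pos[of k 0] by (auto simp: zero_le_mult_iff mult_le_0_iff)
    obtain B where B: "0 \<le> B" "\<And>is x. length is \<le> r \<Longrightarrow> w k x * norm (pderivs is \<theta> x) \<le> B"
      using test_space_bound[OF \<theta>] by metis
    obtain S where S: "\<And>c K. (\<Sum>j<K. w k (c - e j) * norm (\<phi> (c - e j))) \<le> S"
      using weighted_lattice_sum_bounded[OF \<phi> e] by metis
    have "w l x * norm (pderivs is (kernel_section \<phi> c) x) \<le> C * B * S" if l: "length is \<le> r"
      for c "is" x
    proof -
      let ?t = "\<lambda>j. \<phi> (c - e j) * pderivs is \<theta> (x - (e j - c))"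
      have st: "summable (\<lambda>j. norm (?t j))"
        by (rule translates_norm_summable[OF translates l])
      have wt: "w l x * norm (?t j) \<le> C * B * (w k (c - e j) * norm (\<phi> (c - e j)))" for j
      proof -
        let ?y = "x - (e j - c)"
        have "w l x = w l (?y - (c - e j))"
          by simp
        also have "\<dots> \<le> C * (w k ?y * w k (c - e j))"
          by (rule C)
        finally have "w l x * norm (?t j) \<le> C * (w k ?y * w k (c - e j)) * norm (?t j)"
          by (rule mult_right_mono) simp
        also have "\<dots> = C * (w k (c - e j) * norm (\<phi> (c - e j))) * (w k ?y * norm (pderivs is \<theta> ?y))"
          by (simp add: norm_mult mult_ac)
        also have "\<dots> \<le> C * (w k (c - e j) * norm (\<phi> (c - e j))) * B"
          using C0 less_imp_le[OF weight_pos] by (intro mult_left_mono B l mult_nonneg_nonneg) auto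
        finally show ?thesis
          by (simp add: mult_ac)
      qed
      have "pderivs is (kernel_section \<phi> c) =
          (\<lambda>x. \<Sum>j. \<phi> (c - e j) * pderivs is \<theta> (x - (e j - c)))"
        unfolding series by (rule pderivs_translates[OF translates l])
      then have "norm (pderivs is (kernel_section \<phi> c) x) \<le> (\<Sum>j. norm (?t j))"
        by (simp add: summable_norm[OF st])
      then have "w l x * norm (pderivs is (kernel_section \<phi> c) x) \<le> w l x * (\<Sum>j. norm (?t j))"
        by (rule mult_left_mono) (rule less_imp_le[OF weight_pos])
      also have "\<dots> = (\<Sum>j. w l x * norm (?t j))"
        by (rule suminf_mult[OF st, symmetric])
      also have "\<dots> \<le> (\<Sum>j. C * B * (w k (c - e j) * norm (\<phi> (c - e j))))"
        by (rule suminf_le[OF wt summable_mult[OF st] summable_mult[OF summ]])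
      also have "\<dots> = C * B * (\<Sum>j. w k (c - e j) * norm (\<phi> (c - e j)))"
        by (rule suminf_mult[OF summ])
      also have "\<dots> \<le> C * B * S"
        using C0 B by (intro mult_left_mono suminf_le_const summ S) auto
      finally show ?thesis .
    qed
    then show ?thesis
      by blast
  qed
  have mem: "kernel_section \<phi> c \<in> test_space w r" for c
  proof (rule test_spaceI)
    show "kernel_section \<phi> c \<in> C_r r"
      unfolding series by (rule C_r_translates[OF translates])
  qed (use bound in blast)
  moreover have "\<exists>C. \<forall>\<psi>\<in>range (kernel_section \<phi>). test_norm w r l \<psi> \<le> C" for l
  proof -
    obtain C where "\<And>c is x. length is \<le> r \<Longrightarrow>
        w l x * norm (pderivs is (kernel_section \<phi> c) x) \<le> C"
      using bound by blast
    then have le: "v \<le> C" if "v \<in> test_values w r l (kernel_section \<phi> c)" for v c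
      using that by (auto simp: test_values_def)
    \<comment> \<open>The supremum defining the norm is taken over a nonempty set: the empty word at
      the origin is always available.\<close>
    have "w l 0 * norm (pderivs [] (kernel_section \<phi> c) 0)
        \<in> test_values w r l (kernel_section \<phi> c)" for c
      unfolding test_values_def using le0 list.size(3) by fastforce
    then have "test_norm w r l (kernel_section \<phi> c) \<le> C" for c
      unfolding test_norm_def by (intro cSup_least[OF _ le]) blast
    then show ?thesis
      by blast
  qed
  ultimately show ?thesis
    unfolding test_bounded_def by blast
qed

section \<open>Quasiasymptotics of multiresolution expansions\<close>

text \<open>The kernel at \<open>x\<^sub>0\<close> is the section at \<open>c\<close> composed with
  \<open>y \<mapsto> (2 powr \<mu>) *\<^sub>R (y - x\<^sub>0)\<close>, times the Jacobian factor of
  \<open>affine_dist\<close>. Homogeneity of \<open>f\<close> is stated by itself, so that the lemma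
  also applies directly to the translate of \<open>g\<close>.\<close>

lemma q_expansion_eq_affine_dist:
  assumes f: "\<And>a \<psi>. \<psi> \<in> test_space w r \<Longrightarrow> f (\<lambda>x. a * \<psi> x) = a * f \<psi>"
    and \<phi>: "\<phi> \<in> test_space w r"
  shows "q_expansion \<phi> \<mu> f x\<^sub>0 = affine_dist f x\<^sub>0 (2 powr - \<mu>) (kernel_section \<phi> ((2 powr \<mu>) *\<^sub>R x\<^sub>0))"
proof -
  define c where "c = (2 powr \<mu>) *\<^sub>R x\<^sub>0"
  define \<psi> where "\<psi> = (\<lambda>y. kernel_section \<phi> c ((2 powr \<mu>) *\<^sub>R (y - x\<^sub>0)))"
  have "kernel_section \<phi> c \<in> test_space w r"
    using kernel_sections_bounded[OF \<phi>] by (auto simp: test_bounded_def)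
  then have "\<psi> \<in> test_space w r"
    using test_space_affine[OF bounded_linear_ident, of _ r "2 powr \<mu>" "- c"]
    by (simp add: \<psi>_def c_def scaleR_diff_right)
  moreover have "q_kernel \<phi> \<mu> x\<^sub>0 y = complex_of_real (2 powr (CARD('n) * \<mu>)) * \<psi> y" for y
    by (simp add: q_kernel_def \<psi>_def kernel_section_def c_def scaleR_diff_right)
  ultimately have "q_expansion \<phi> \<mu> f x\<^sub>0 = complex_of_real (2 powr (CARD('n) * \<mu>)) * f \<psi>"
    by (simp add: q_expansion_def f)
  moreover have "1 / (2 powr - \<mu>) ^ CARD('n) = 2 powr (CARD('n) * \<mu>)"
    by (simp add: powr_minus_divide powr_power mult.commute power_divide)
  ultimately show ?thesis
    unfolding affine_dist_def c_def[symmetric] by (simp add: \<psi>_def powr_minus_divide)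
qed

text \<open>A single test function forms a bounded set. Convergence at individual test functions is
  what the homogeneity argument uses.\<close>

lemma strong_limit_tendsto:
  assumes "strong_limit w r h g F" "\<psi> \<in> test_space w r"
  shows "((\<lambda>\<epsilon>. h \<epsilon> \<psi>) \<longlongrightarrow> g \<psi>) F"
proof -
  have "test_bounded w r {\<psi>}"
    using assms(2) by (auto simp: test_bounded_def)
  then have "uniform_limit {\<psi>} h g F"
    using assms(1) unfolding strong_limit_def by blast
  then show ?thesis
    by (rule tendsto_uniform_limitI) simp
qed

end

lemma dual_space_scale:
  "f \<in> dual_space w r \<Longrightarrow> \<psi> \<in> test_space w r \<Longrightarrow> f (\<lambda>x. a * \<psi> x) = a * f \<psi>"
  unfolding dual_space_def
  by (drule CollectD, drule conjunct1, drule bspec, assumption, drule bspec[of _ _ \<psi>], assumption,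
      drule spec[of _ a], drule spec[of _ 0], simp)

lemma slowly_varying_pos:
  assumes "slowly_varying L"
  shows "\<forall>\<^sub>F \<epsilon> in at_right 0. 0 < L \<epsilon>"
proof -
  obtain A where "A > 0" "\<forall>\<epsilon>\<in>{0<..A}. 0 < L \<epsilon>"
    using assms unfolding slowly_varying_def by blast
  then show ?thesis
    unfolding eventually_at_right_field by (intro exI[of _ A]) auto
qed

text \<open>
  Replacing \<open>\<epsilon>\<close> by \<open>a * \<epsilon>\<close> in the limit and using slow variation of \<open>L\<close> shows that the limit is
  homogeneous of degree \<open>\<alpha>\<close>.
\<close>

lemma (in growing_weight) quasiasymptotic_limit_homogeneous:
  assumes L: "slowly_varying L" and f: "f \<in> dual_space w r" and g: "g \<in> dual_space w r"
    and lim: "strong_limit w r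
           (\<lambda>\<epsilon> \<psi>. affine_dist f x\<^sub>0 \<epsilon> \<psi> / complex_of_real (\<epsilon> powr \<alpha> * L \<epsilon>)) g (at_right 0)"
    and \<psi>: "\<psi> \<in> test_space w r" and a: "0 < a"
  shows "affine_dist g 0 a \<psi> = complex_of_real (a powr \<alpha>) * g \<psi>"
proof -
  define s where "s = complex_of_real (1 / a ^ CARD('n))"
  define \<psi>\<^sub>a where "\<psi>\<^sub>a = (\<lambda>x. \<psi> ((1 / a) *\<^sub>R x))"
  have \<psi>\<^sub>a: "(\<lambda>x. \<psi>\<^sub>a (b *\<^sub>R x + d)) \<in> test_space w r" if "b \<noteq> 0" for b d
    using test_space_affine[OF bounded_linear_ident \<psi>, of "b / a" "(1 / a) *\<^sub>R d"] a that
    by (simp add: \<psi>\<^sub>a_def scaleR_add_right)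
  have \<psi>\<^sub>a1: "\<psi>\<^sub>a \<in> test_space w r"
    using \<psi>\<^sub>a[of 1 0] by simp
  have s\<psi>\<^sub>a: "(\<lambda>x. s * \<psi>\<^sub>a x) \<in> test_space w r"
    using test_space_affine[OF bounded_linear_mult_right \<psi>\<^sub>a1, of 1 s 0] by simp
  have g_eq: "g (\<lambda>x. s * \<psi>\<^sub>a x) = affine_dist g 0 a \<psi>"
    unfolding dual_space_scale[OF g \<psi>\<^sub>a1] by (simp add: affine_dist_def s_def \<psi>\<^sub>a_def)
  \<comment> \<open>Dilating the test function by \<open>a\<close>, with the Jacobian
    \<open>s\<close>, changes the scale of the distribution from \<open>\<epsilon>\<close> to
    \<open>a * \<epsilon>\<close>.\<close>
  have f_eq: "affine_dist f x\<^sub>0 \<epsilon> (\<lambda>x. s * \<psi>\<^sub>a x) = affine_dist f x\<^sub>0 (a * \<epsilon>) \<psi>" if "\<epsilon> > 0" for \<epsilon>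
  proof -
    have "(\<lambda>y. \<psi>\<^sub>a ((1 / \<epsilon>) *\<^sub>R (y - x\<^sub>0))) \<in> test_space w r"
      using \<psi>\<^sub>a[of "1 / \<epsilon>" "- (1 / \<epsilon>) *\<^sub>R x\<^sub>0"] that by (simp add: scaleR_diff_right)
    from dual_space_scale[OF f this, of s] show ?thesis
      by (simp add: affine_dist_def s_def \<psi>\<^sub>a_def power_mult_distrib mult_ac)
  qed
  have lim1: "((\<lambda>\<epsilon>. affine_dist f x\<^sub>0 (a * \<epsilon>) \<psi> / complex_of_real (\<epsilon> powr \<alpha> * L \<epsilon>)) \<longlongrightarrow>
      affine_dist g 0 a \<psi>) (at_right 0)"
    using strong_limit_tendsto[OF lim s\<psi>\<^sub>a] unfolding g_eq
    by (rule Lim_transform_eventually)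
      (auto simp: f_eq eventually_at_right_less intro!: eventually_mono[OF eventually_at_right_less])
  have scale: "filterlim (\<lambda>\<epsilon>. a * \<epsilon>) (at_right 0) (at_right (0::real))"
    unfolding filterlim_at
    using a by (auto intro!: tendsto_eq_intros eventually_mono[OF eventually_at_right_less])
  \<comment> \<open>The same quotient is regrouped around the normalization at scale
    \<open>a * \<epsilon>\<close>; the ratio of the normalizations tends to
    \<open>a powr \<alpha>\<close> by slow variation.\<close>
  have "((\<lambda>\<epsilon>. complex_of_real (a powr \<alpha> * (L (a * \<epsilon>) / L \<epsilon>)) *
      (affine_dist f x\<^sub>0 (a * \<epsilon>) \<psi> / complex_of_real ((a * \<epsilon>) powr \<alpha> * L (a * \<epsilon>)))) \<longlongrightarrow>
      complex_of_real (a powr \<alpha> * 1) * g \<psi>) (at_right 0)"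
    using L a filterlim_compose[OF strong_limit_tendsto[OF lim \<psi>] scale]
    by (intro tendsto_intros) (auto simp: slowly_varying_def)
  then have lim2: "((\<lambda>\<epsilon>. affine_dist f x\<^sub>0 (a * \<epsilon>) \<psi> / complex_of_real (\<epsilon> powr \<alpha> * L \<epsilon>)) \<longlongrightarrow>
      complex_of_real (a powr \<alpha> * 1) * g \<psi>) (at_right 0)"
  proof (rule Lim_transform_eventually)
    \<comment> \<open>\<open>L\<close> is positive only near the origin, so the cancellation is
      valid only eventually.\<close>
    have "\<forall>\<^sub>F \<epsilon> in at_right 0. 0 < L (a * \<epsilon>)"
      using filterlim_iff[THEN iffD1, OF scale] slowly_varying_pos[OF L] by blast
    then show "\<forall>\<^sub>F \<epsilon> in at_right 0.
        complex_of_real (a powr \<alpha> * (L (a * \<epsilon>) / L \<epsilon>)) *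
        (affine_dist f x\<^sub>0 (a * \<epsilon>) \<psi> / complex_of_real ((a * \<epsilon>) powr \<alpha> * L (a * \<epsilon>))) =
        affine_dist f x\<^sub>0 (a * \<epsilon>) \<psi> / complex_of_real (\<epsilon> powr \<alpha> * L \<epsilon>)"
      using slowly_varying_pos[OF L] eventually_at_right_less
    proof eventually_elim
      case (elim \<epsilon>)
      then show ?case
        using a by (simp add: powr_mult field_simps)
    qed
  qed
  show ?thesis
    using tendsto_unique[OF _ lim1 lim2] by simp
qed

theorem theorem5p3:
  fixes r :: nat and \<alpha> :: real and x\<^sub>0 :: "real^'n" and L M :: "real \<Rightarrow> real"
    and w :: "'n weights" and f g :: "'n functional"
    and V :: "int \<Rightarrow> (real^'n \<Rightarrow> complex) set" and \<phi> :: "real^'n \<Rightarrow> complex"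
  assumes "admissible M \<and> w = K_weight M \<or> w = S_weight"
    and "slowly_varying L"
    and "f \<in> dual_space w r" and "g \<in> dual_space w r"
    and "strong_limit w r
           (\<lambda>\<epsilon> \<psi>. affine_dist f x\<^sub>0 \<epsilon> \<psi> / complex_of_real (\<epsilon> powr \<alpha> * L \<epsilon>)) g (at_right 0)"
    and "is_MRA V" and "scaling_function V \<phi>" and "\<phi> \<in> test_space w r"
  shows "(\<lambda>\<mu>. q_expansion \<phi> \<mu> f x\<^sub>0 -
               complex_of_real (L (2 powr (- \<mu>))) * q_expansion \<phi> \<mu> (translate_dist g x\<^sub>0) x\<^sub>0)
         \<in> o[at_top](\<lambda>\<mu>. complex_of_real (2 powr (- \<alpha> * \<mu>) * L (2 powr (- \<mu>))))"
proof -
  interpret growing_weight w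
    using assms(1) growing_K_weight growing_S_weight by auto
  note L = assms(2) and f = assms(3) and g = assms(4) and lim = assms(5) and \<phi> = assms(8)
  define \<psi> where "\<psi> = (\<lambda>\<mu>. kernel_section \<phi> ((2 powr \<mu>) *\<^sub>R x\<^sub>0))"
  define h where "h = (\<lambda>\<epsilon> \<psi>. affine_dist f x\<^sub>0 \<epsilon> \<psi> / complex_of_real (\<epsilon> powr \<alpha> * L \<epsilon>))"
  have \<psi>: "\<psi> \<mu> \<in> test_space w r" for \<mu>
    using kernel_sections_bounded[OF \<phi>] by (auto simp: test_bounded_def \<psi>_def)
  have qf: "q_expansion \<phi> \<mu> f x\<^sub>0 = affine_dist f x\<^sub>0 (2 powr - \<mu>) (\<psi> \<mu>)" for \<mu>
    unfolding \<psi>_def by (rule q_expansion_eq_affine_dist[OF dual_space_scale[OF f] \<phi>])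
  have tr: "translate_dist g x\<^sub>0 (\<lambda>x. a * \<eta> x) = a * translate_dist g x\<^sub>0 \<eta>"
    if "\<eta> \<in> test_space w r" for a \<eta>
    using dual_space_scale[OF g test_space_affine[OF bounded_linear_ident that, of 1 x\<^sub>0]]
    by (simp add: translate_dist_def affine_dist_def)
  have qg: "q_expansion \<phi> \<mu> (translate_dist g x\<^sub>0) x\<^sub>0 = complex_of_real (2 powr (- \<alpha> * \<mu>)) * g (\<psi> \<mu>)"
    for \<mu>
  proof -
    have "q_expansion \<phi> \<mu> (translate_dist g x\<^sub>0) x\<^sub>0 = affine_dist (translate_dist g x\<^sub>0) x\<^sub>0 (2 powr - \<mu>) (\<psi> \<mu>)"
      unfolding \<psi>_def by (rule q_expansion_eq_affine_dist[OF tr \<phi>])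
    \<comment> \<open>The translation of \<open>g\<close> by \<open>x\<^sub>0\<close> and the
      expansion about \<open>x\<^sub>0\<close> cancel.\<close>
    also have "\<dots> = affine_dist g 0 (2 powr - \<mu>) (\<psi> \<mu>)"
      by (simp add: translate_dist_def affine_dist_def)
    also have "\<dots> = complex_of_real ((2 powr - \<mu>) powr \<alpha>) * g (\<psi> \<mu>)"
      by (rule quasiasymptotic_limit_homogeneous[OF L f g lim \<psi>]) simp
    finally show ?thesis
      by (simp add: powr_powr mult.commute)
  qed
  have pw: "filterlim (\<lambda>\<mu>. 2 powr - \<mu> :: real) (at_right 0) at_top"
    unfolding filterlim_at powr_def
    by (auto intro!: filterlim_compose[OF exp_at_bot] filterlim_compose[OF filterlim_uminus_at_bot_at_top]
        filterlim_at_top_mult_tendsto_pos[OF tendsto_const] filterlim_ident)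
  have "uniform_limit (range (kernel_section \<phi>)) h g (at_right 0)"
    using lim kernel_sections_bounded[OF \<phi>] by (simp add: strong_limit_def h_def)
  \<comment> \<open>The estimate holds for all \<open>c\<close> at once. This is essential because
    the centre \<open>(2 powr \<mu>) *\<^sub>R x\<^sub>0\<close> moves with
    \<open>\<mu>\<close>.\<close>
  then have ul: "\<forall>\<^sub>F \<epsilon> in at_right 0. \<forall>c. dist (h \<epsilon> (kernel_section \<phi> c)) (g (kernel_section \<phi> c)) < d"
    if "d > 0" for d
    using that by (auto simp: uniform_limit_iff)
  show ?thesis
  proof (rule landau_o.smallI)
    fix d :: real
    assume "d > 0"
    have "\<forall>\<^sub>F \<mu> in at_top. 0 < L (2 powr - \<mu>) \<and>
        (\<forall>c. dist (h (2 powr - \<mu>) (kernel_section \<phi> c)) (g (kernel_section \<phi> c)) < d)"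
      using filterlim_iff[THEN iffD1, OF pw] eventually_conj[OF slowly_varying_pos[OF L] ul[OF \<open>d > 0\<close>]]
      by blast
    then show "\<forall>\<^sub>F \<mu> in at_top.
        norm (q_expansion \<phi> \<mu> f x\<^sub>0 -
               complex_of_real (L (2 powr - \<mu>)) * q_expansion \<phi> \<mu> (translate_dist g x\<^sub>0) x\<^sub>0)
        \<le> d * norm (complex_of_real (2 powr (- \<alpha> * \<mu>) * L (2 powr - \<mu>)))"
    proof eventually_elim
      case (elim \<mu>)
      \<comment> \<open>\<open>N\<close> is the comparison function. By homogeneity both terms of
        the difference carry it as a factor, leaving \<open>N\<close> times \<open>h - g\<close> at
        the same section.\<close>
      define N where "N = 2 powr (- \<alpha> * \<mu>) * L (2 powr - \<mu>)"
      have "N > 0"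
        using elim by (simp add: N_def)
      have "(2 powr - \<mu>) powr \<alpha> * L (2 powr - \<mu>) = N"
        by (simp add: N_def powr_powr mult.commute)
      then have "affine_dist f x\<^sub>0 (2 powr - \<mu>) (\<psi> \<mu>) = complex_of_real N * h (2 powr - \<mu>) (\<psi> \<mu>)"
        using \<open>N > 0\<close> by (simp add: h_def del: of_real_mult)
      then have "q_expansion \<phi> \<mu> f x\<^sub>0 -
          complex_of_real (L (2 powr - \<mu>)) * q_expansion \<phi> \<mu> (translate_dist g x\<^sub>0) x\<^sub>0
          = complex_of_real N * (h (2 powr - \<mu>) (\<psi> \<mu>) - g (\<psi> \<mu>))"
        unfolding qf qg by (simp add: N_def algebra_simps)
      then have "norm (q_expansion \<phi> \<mu> f x\<^sub>0 -
          complex_of_real (L (2 powr - \<mu>)) * q_expansion \<phi> \<mu> (translate_dist g x\<^sub>0) x\<^sub>0)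
          = N * dist (h (2 powr - \<mu>) (\<psi> \<mu>)) (g (\<psi> \<mu>))"
        using \<open>N > 0\<close> by (simp add: norm_mult dist_norm)
      also have "\<dots> \<le> N * d"
        using elim \<open>N > 0\<close> by (intro mult_left_mono) (auto simp: \<psi>_def less_imp_le)
      finally show ?case
        using \<open>N > 0\<close> unfolding N_def[symmetric] by (simp add: mult.commute)
    qed
  qed
qed

end
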